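(* Let $h$ and $p_*$ be as in the context. Suppose the function $|h|:\mathbb R^n\to\mathbb R_+$ is not identically constant and $$\theta_*:=\sup\{\theta\ge0:\ \mathbf E_*e^{\theta|h|^2}<+\infty\}>0 .$$ Let $\Psi(\theta):=\ln\mathbf E_*e^{\theta|h|^2}$ and $\nu(\theta):=\theta\Psi'(\theta)-\Psi(\theta)$ for $\theta\in[0,\theta_* )$, and, for $K>0$ small, let $\theta_K\in(2K,\theta_* )$ be the unique solution $\theta=\theta_K$ of the equation $\nu(\theta)-2K\Psi'(\theta)=0$. Then $$\nu(\theta_K)=2\,\mathbf E_*(|h|^2)\,K+4\sqrt{\mathbf E_*(|h|^2)\,\mathbf{var}_*(|h|^2)}\;K^{3/2}+o(K^{3/2}),\qquad\text{as }K\to0+,$$ where $\mathbf{var}_*(|h|^2)=\mathbf E_*(|h|^4)-(\mathbf E_*(|h|^2))^2$.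
   Context: $h\in C^1(\mathbb R^n,\mathbb R^m)$ is a Lipschitz map (the drift of the noise). $p_*\in C^2(\mathbb R^n,\mathbb R_+)$ is an everywhere positive probability density function on $\mathbb R^n$, namely the (unique) invariant PDF of the nominal Ito SDE $dX_t=f(X_t)\,dt+g(X_t)\,dV_t$ with Lipschitz maps $f\in C^1(\mathbb R^n,\mathbb R^n)$, $g\in C^2(\mathbb R^n,\mathbb R^{n\times m})$ and a standard Wiener process $V$ in $\mathbb R^m$; that is, with $D:=gg^{\mathrm T}$, it satisfies $\tfrac12\sum_{j,k}\partial_{x_j}\partial_{x_k}(p_*D_{jk})-\mathrm{div}(p_*f)=0$. $\mathbf E_*(\cdot)$ and $\mathbf{var}_*(\cdot)$ denote the expectation and variance over $p_*$, e.g. $\mathbf E_*\varphi=\int_{\mathbb R^n}\varphi(x)p_*(x)\,dx$. In the asymptotic relation, $K$ is treated as a free positive parameter tending to $0$ with $h$ and $p_*$ fixed. *)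

theory Defs
  imports "HOL-Analysis.Analysis" "HOL-Library.Landau_Symbols"
begin

definition C1 :: "('a::real_normed_vector \<Rightarrow> 'b::real_normed_vector) \<Rightarrow> bool" where
  "C1 f \<longleftrightarrow> (\<exists>f' :: 'a \<Rightarrow> 'a \<Rightarrow>\<^sub>L 'b.
     (\<forall>x. (f has_derivative blinfun_apply (f' x)) (at x)) \<and> continuous_on UNIV f')"

definition C2 :: "('a::real_normed_vector \<Rightarrow> 'b::real_normed_vector) \<Rightarrow> bool" where
  "C2 f \<longleftrightarrow> (\<exists>f' :: 'a \<Rightarrow> 'a \<Rightarrow>\<^sub>L 'b.
     (\<forall>x. (f has_derivative blinfun_apply (f' x)) (at x)) \<and> C1 f')"

definition lipschitz_map :: "('a::metric_space \<Rightarrow> 'b::metric_space) \<Rightarrow> bool" where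
  "lipschitz_map f \<longleftrightarrow> (\<exists>L. L-lipschitz_on UNIV f)"

definition partial :: "'n \<Rightarrow> (real ^ 'n::finite \<Rightarrow> real) \<Rightarrow> real ^ 'n \<Rightarrow> real" where
  "partial i \<phi> x = deriv (\<lambda>t. \<phi> (x + t *\<^sub>R axis i 1)) 0"

definition divergence :: "(real ^ 'n::finite \<Rightarrow> real ^ 'n) \<Rightarrow> real ^ 'n \<Rightarrow> real" where
  "divergence v x = (\<Sum>i\<in>UNIV. partial i (\<lambda>y. v y $ i) x)"

definition diffusion :: "(real ^ 'n \<Rightarrow> real ^ 'm ^ 'n) \<Rightarrow> real ^ 'n::finite \<Rightarrow> real ^ 'n ^ 'n" where
  "diffusion g x = g x ** transpose (g x)"

(* Invariance of p for dX = f(X) dt + g(X) dV is expressed by the stationary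
   Fokker-Planck-Kolmogorov equation. *)
definition invariant_pdf ::
  "(real ^ 'n \<Rightarrow> real ^ 'n) \<Rightarrow> (real ^ 'n \<Rightarrow> real ^ 'm ^ 'n) \<Rightarrow> (real ^ 'n::finite \<Rightarrow> real) \<Rightarrow> bool" where
  "invariant_pdf f g p \<longleftrightarrow>
     C2 p \<and> (\<forall>x. p x > 0) \<and> (\<integral>\<^sup>+ x. ennreal (p x) \<partial>lborel) = 1 \<and>
     (\<forall>x. 1/2 * (\<Sum>j\<in>UNIV. \<Sum>k\<in>UNIV. partial j (partial k (\<lambda>y. p y * diffusion g y $ j $ k)) x)
           - divergence (\<lambda>y. p y *\<^sub>R f y) x = 0)"

definition expect :: "(real ^ 'n::finite \<Rightarrow> real) \<Rightarrow> (real ^ 'n \<Rightarrow> real) \<Rightarrow> real" where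
  "expect p \<phi> = (LINT x|lborel. \<phi> x * p x)"

definition var :: "(real ^ 'n::finite \<Rightarrow> real) \<Rightarrow> (real ^ 'n \<Rightarrow> real) \<Rightarrow> real" where
  "var p \<phi> = expect p (\<lambda>x. (\<phi> x - expect p \<phi>)\<^sup>2)"

(* The supremum may be infinite, hence ereal. Finiteness of the expectation is tested with
   the nonnegative integral, because the Bochner integral of a non-integrable function is 0. *)
definition theta_star :: "(real ^ 'n::finite \<Rightarrow> real) \<Rightarrow> (real ^ 'n \<Rightarrow> real ^ 'm) \<Rightarrow> ereal" where
  "theta_star p h = (SUP \<theta> \<in> {\<theta>::real. \<theta> \<ge> 0 \<and>
     (\<integral>\<^sup>+ x. ennreal (exp (\<theta> * (norm (h x))\<^sup>2) * p x) \<partial>lborel) < \<infinity>}. ereal \<theta>)"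

(* Meaningful for \<theta> < theta_star p h only, with theta_star p h > 0. For \<theta> < 0 the expectation is finite as well,
   so the two-sided derivative in nu below is also the right one at \<theta> = 0. *)
definition Psi :: "(real ^ 'n::finite \<Rightarrow> real) \<Rightarrow> (real ^ 'n \<Rightarrow> real ^ 'm) \<Rightarrow> real \<Rightarrow> real" where
  "Psi p h \<theta> = ln (expect p (\<lambda>x. exp (\<theta> * (norm (h x))\<^sup>2)))"

definition nu :: "(real ^ 'n::finite \<Rightarrow> real) \<Rightarrow> (real ^ 'n \<Rightarrow> real ^ 'm) \<Rightarrow> real \<Rightarrow> real" where
  "nu p h \<theta> = \<theta> * deriv (Psi p h) \<theta> - Psi p h \<theta>"

definition is_theta_K ::
  "(real ^ 'n::finite \<Rightarrow> real) \<Rightarrow> (real ^ 'n \<Rightarrow> real ^ 'm) \<Rightarrow> real \<Rightarrow> real \<Rightarrow> bool" where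
  "is_theta_K p h K \<theta> \<longleftrightarrow> 2 * K < \<theta> \<and> ereal \<theta> < theta_star p h \<and>
     nu p h \<theta> - 2 * K * deriv (Psi p h) \<theta> = 0"

definition theta_K ::
  "(real ^ 'n::finite \<Rightarrow> real) \<Rightarrow> (real ^ 'n \<Rightarrow> real ^ 'm) \<Rightarrow> real \<Rightarrow> real" where
  "theta_K p h K = (THE \<theta>. is_theta_K p h K \<theta>)"

end

theory Submission
  imports Defs
begin

text \<open>
  Write \<open>m\<close> and \<open>v\<close> for the mean and the variance of \<open>|h|\<^sup>2\<close>. The moment generating function may be
  differentiated under the integral to the left of \<open>theta_star\<close>, so \<open>\<Psi>' 0 = m\<close>, \<open>\<Psi>'' 0 = v\<close>, and \<open>\<Psi>''\<close> is
  the variance under a tilted measure, which is positive because \<open>|h|\<close> is continuous and not constant.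
  Hence \<open>\<theta> \<mapsto> \<nu> \<theta> - 2 K \<Psi>' \<theta>\<close>, with derivative \<open>(\<theta> - 2 K) \<Psi>'' \<theta>\<close>, increases from the negative value
  \<open>- \<Psi> (2 K)\<close> at \<open>2 K\<close> and has exactly one root, which tends to \<open>0\<close> with \<open>K\<close>. At the root
  \<open>K = \<nu> \<theta> / (2 \<Psi>' \<theta>)\<close>, which is asymptotic to \<open>v \<theta>\<^sup>2 / (4 m)\<close>; thus \<open>\<theta>\<close> is asymptotic to
  \<open>2 sqrt (m K / v)\<close>, and inserting this into \<open>\<nu> \<theta> = 2 K \<Psi>' \<theta> = 2 K (m + v \<theta> + o \<theta>)\<close> gives the expansion.
\<close>

section \<open>Exponential moments: differentiation under the integral and strict positivity\<close>

text \<open>Dominates the difference quotients of \<open>exp (t * x)\<close> in \<open>t\<close>,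
  uniformly for \<open>\<bar>t\<bar> \<le> d\<close>. Both signs of \<open>t\<close> reduce to
  \<open>y * exp y\<close> with \<open>y = \<bar>t\<bar> * x\<close>.\<close>

lemma abs_exp_minus_one_le:
  fixes t d x :: real
  assumes "0 \<le> x" "\<bar>t\<bar> \<le> d"
  shows "\<bar>exp (t * x) - 1\<bar> \<le> \<bar>t\<bar> * (x * exp (d * x))"
proof -
  define y where "y = \<bar>t\<bar> * x"
  have y: "0 \<le> y" "y \<le> d * x"
    unfolding y_def using assms by (auto intro: mult_right_mono)
  have "\<bar>exp (t * x) - 1\<bar> \<le> y * exp y"
  proof (cases "0 \<le> t")
    case True
    then have "t * x = y" by (simp add: y_def)
    moreover have "(1 - y) * exp y \<le> exp (- y) * exp y"
      using exp_ge_add_one_self[of "- y"] by (intro mult_right_mono) auto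
    then have "exp y - 1 \<le> y * exp y"
      by (simp add: algebra_simps flip: exp_add)
    moreover have "1 \<le> exp y" using y by simp
    ultimately show ?thesis by simp
  next
    case False
    then have "t * x = - y" by (simp add: y_def)
    moreover have "1 - exp (- y) \<le> y" using exp_ge_add_one_self[of "- y"] by linarith
    moreover have "y * 1 \<le> y * exp y" using y by (intro mult_left_mono) auto
    moreover have "exp (- y) \<le> 1" using y by simp
    ultimately show ?thesis by simp
  qed
  also have "\<dots> \<le> y * exp (d * x)" using y by (intro mult_left_mono) auto
  finally show ?thesis by (simp add: y_def)
qed

lemma power_over_fact_le_exp:
  fixes x :: real
  assumes "0 \<le> x"
  shows "x ^ k / fact k \<le> exp x"
proof -
  have "(\<Sum>n\<in>{k}. x ^ n /\<^sub>R fact n) \<le> (\<Sum>n. x ^ n /\<^sub>R fact n)"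
    using assms by (intro sum_le_suminf summable_exp_generic) auto
  then show ?thesis by (simp add: exp_def divide_inverse mult.commute)
qed

text \<open>The gap \<open>b - a\<close> pays for the power: one term of the exponential series
  bounds \<open>X x ^ k\<close> by a constant times \<open>exp ((b - a) * X x)\<close>.\<close>

lemma integrable_power_times_exp:
  fixes X :: "'a \<Rightarrow> real"
  assumes [measurable]: "X \<in> borel_measurable M"
    and nonneg: "\<And>x. 0 \<le> X x"
    and int: "integrable M (\<lambda>x. exp (b * X x))"
    and "a < b"
  shows "integrable M (\<lambda>x. X x ^ k * exp (a * X x))"
proof (rule Bochner_Integration.integrable_bound)
  define d where "d = b - a"
  have d: "0 < d" using \<open>a < b\<close> by (simp add: d_def)
  show "integrable M (\<lambda>x. fact k / d ^ k * exp (b * X x))"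
    using int by simp
  show "AE x in M. norm (X x ^ k * exp (a * X x)) \<le> norm (fact k / d ^ k * exp (b * X x))"
  proof (rule AE_I2)
    fix x
    have "(d * X x) ^ k / fact k \<le> exp (d * X x)"
      using d nonneg[of x] by (intro power_over_fact_le_exp) auto
    then have "X x ^ k \<le> fact k / d ^ k * exp (d * X x)"
      using d by (simp add: field_simps power_mult_distrib)
    then have "X x ^ k * exp (a * X x) \<le> fact k / d ^ k * exp (d * X x) * exp (a * X x)"
      by (rule mult_right_mono) simp
    also have "\<dots> = fact k / d ^ k * exp (b * X x)"
      by (simp add: d_def algebra_simps flip: exp_add)
    finally show "norm (X x ^ k * exp (a * X x)) \<le> norm (fact k / d ^ k * exp (b * X x))"
      using d nonneg[of x] by simp
  qed
qed measurable

text \<open>Dominated convergence of the difference quotients along an arbitrary sequence of nonzero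
  increments tending to 0.\<close>

lemma has_derivative_integral_power_times_exp:
  fixes X :: "'a \<Rightarrow> real"
  assumes X[measurable]: "X \<in> borel_measurable M"
    and nonneg: "\<And>x. 0 \<le> X x"
    and int: "integrable M (\<lambda>x. exp (b * X x))"
    and "a < b"
  shows "((\<lambda>\<theta>. LINT x|M. X x ^ k * exp (\<theta> * X x)) has_real_derivative
            (LINT x|M. X x ^ Suc k * exp (a * X x))) (at a)"
proof -
  let ?m = "\<lambda>\<theta>. LINT x|M. X x ^ k * exp (\<theta> * X x)"
  let ?D = "LINT x|M. X x ^ Suc k * exp (a * X x)"
  \<comment> \<open>Half the gap: increments below \<open>d\<close> stay under \<open>a + d\<close>,
    and \<open>a + d < b\<close> leaves room to integrate one more power of
    \<open>X\<close>.\<close>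
  define d where "d = (b - a) / 2"
  have d: "0 < d" "a + d < b" using \<open>a < b\<close> by (auto simp: d_def field_simps)
  note I = integrable_power_times_exp[OF X nonneg int]
  have "(\<lambda>i. (?m (a + s i) - ?m a) / s i) \<longlonglongrightarrow> ?D"
    if s0: "\<And>i. s i \<noteq> 0" and slim: "s \<longlonglongrightarrow> 0" for s :: "nat \<Rightarrow> real"
  proof -
    have "eventually (\<lambda>n. \<bar>s n\<bar> < d) sequentially"
      using order_tendstoD(2)[OF tendsto_rabs_zero[OF slim] d(1)] .
    then obtain N where N: "\<And>n. n \<ge> N \<Longrightarrow> \<bar>s n\<bar> < d"
      by (auto simp: eventually_sequentially)
    \<comment> \<open>Dominated convergence wants the bound for every index, so the first
      \<open>N\<close> terms are dropped; \<open>LIMSEQ_offset\<close> restores them at the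
      end.\<close>
    define r where "r n = s (n + N)" for n
    have r: "r n \<noteq> 0" "\<bar>r n\<bar> < d" for n using N s0 by (auto simp: r_def)
    have rlim: "r \<longlonglongrightarrow> 0" unfolding r_def by (rule LIMSEQ_ignore_initial_segment[OF slim])
    let ?q = "\<lambda>n x. (X x ^ k * exp ((a + r n) * X x) - X x ^ k * exp (a * X x)) / r n"
    have "(\<lambda>n. LINT x|M. ?q n x) \<longlonglongrightarrow> ?D"
    proof (rule integral_dominated_convergence)
      show "integrable M (\<lambda>x. X x ^ Suc k * exp ((a + d) * X x))"
        using d by (intro I) auto
      show "AE x in M. (\<lambda>n. ?q n x) \<longlonglongrightarrow> X x ^ Suc k * exp (a * X x)"
      proof (rule AE_I2)
        fix x
        have "((\<lambda>\<theta>. X x ^ k * exp (\<theta> * X x)) has_real_derivative X x ^ Suc k * exp (a * X x)) (at a)"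
          by (auto intro!: derivative_eq_intros)
        then have "((\<lambda>t. (X x ^ k * exp ((a + t) * X x) - X x ^ k * exp (a * X x)) / t)
                     \<longlongrightarrow> X x ^ Suc k * exp (a * X x)) (at 0)"
          by (simp add: DERIV_def)
        then show "(\<lambda>n. ?q n x) \<longlonglongrightarrow> X x ^ Suc k * exp (a * X x)"
          using r rlim unfolding tendsto_at_iff_sequentially by (auto simp: o_def)
      qed
      show "AE x in M. norm (?q n x) \<le> X x ^ Suc k * exp ((a + d) * X x)" for n
      proof (rule AE_I2)
        fix x
        have "norm (?q n x) = X x ^ k * exp (a * X x) * (\<bar>exp (r n * X x) - 1\<bar> / \<bar>r n\<bar>)"
        proof -
          have "?q n x = X x ^ k * exp (a * X x) * ((exp (r n * X x) - 1) / r n)"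
            using r(1)[of n] by (simp add: distrib_right exp_add field_simps)
          then show ?thesis using nonneg[of x] by (simp only: real_norm_def abs_mult abs_divide) simp
        qed
        also have "\<dots> \<le> X x ^ k * exp (a * X x) * (X x * exp (d * X x))"
          using abs_exp_minus_one_le[of "X x" "r n" d] r[of n] nonneg[of x]
          by (intro mult_left_mono) (auto simp: field_simps)
        also have "\<dots> = X x ^ Suc k * exp ((a + d) * X x)"
          by (simp add: distrib_right exp_add)
        finally show "norm (?q n x) \<le> X x ^ Suc k * exp ((a + d) * X x)" .
      qed
    qed measurable
    moreover have "(LINT x|M. ?q n x) = (?m (a + r n) - ?m a) / r n" for n
    proof -
      have "integrable M (\<lambda>x. X x ^ k * exp ((a + r n) * X x))"
        using d r(2)[of n] by (intro I) auto
      then show ?thesis using I[OF \<open>a < b\<close>] by simp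
    qed
    ultimately have "(\<lambda>n. (?m (a + r n) - ?m a) / r n) \<longlonglongrightarrow> ?D"
      by (simp only:)
    then have "(\<lambda>n. (?m (a + s (n + N)) - ?m a) / s (n + N)) \<longlonglongrightarrow> ?D"
      unfolding r_def .
    then show ?thesis by (rule LIMSEQ_offset)
  qed
  then show ?thesis
    unfolding DERIV_def tendsto_at_iff_sequentially by (auto simp: o_def)
qed

text \<open>A zero integral would make the set where \<open>\<phi>\<close> is positive null for the
  density, hence Lebesgue null since \<open>p\<close> is positive; but this set is open and contains
  \<open>z\<close>.\<close>

lemma integral_density_lborel_pos:
  fixes p \<phi> :: "'a::euclidean_space \<Rightarrow> real"
  assumes p: "continuous_on UNIV p" "\<And>x. 0 < p x"
    and \<phi>: "continuous_on UNIV \<phi>" "\<And>x. 0 \<le> \<phi> x" "0 < \<phi> z"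
    and int: "integrable (density lborel p) \<phi>"
  shows "0 < (LINT x|density lborel p. \<phi> x)"
proof -
  have [measurable]: "p \<in> borel_measurable borel" "\<phi> \<in> borel_measurable borel"
    using p \<phi> by (auto intro: borel_measurable_continuous_onI)
  have "(LINT x|density lborel p. \<phi> x) \<noteq> 0"
  proof
    assume "(LINT x|density lborel p. \<phi> x) = 0"
    then have "AE x in density lborel p. \<phi> x = 0"
      using integral_nonneg_eq_0_iff_AE[OF int] \<phi> by simp
    then have "AE x in lborel. \<phi> x = 0"
      using p by (simp add: AE_density)
    then have "AE x in lebesgue. x \<notin> {x. 0 < \<phi> x}"
      by (auto intro: AE_completion elim: eventually_mono)
    then have "negligible {x. 0 < \<phi> x}"
      by (simp add: negligible_iff_null_sets AE_iff_null_sets)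
    moreover have "open {x. 0 < \<phi> x}"
      by (intro open_Collect_less) (use \<phi> in auto)
    ultimately show False using \<phi>(3) open_not_negligible by blast
  qed
  moreover have "0 \<le> (LINT x|density lborel p. \<phi> x)" using \<phi> by simp
  ultimately show ?thesis by linarith
qed

section \<open>Existence and uniqueness of the root for an abstract convex potential\<close>

text \<open>\<open>P\<close>, \<open>P1\<close>, \<open>P2\<close> and \<open>N\<close> stand for \<open>\<Psi>\<close>, \<open>\<Psi>'\<close>, \<open>\<Psi>''\<close> and \<open>\<nu>\<close>, and \<open>S\<close> for \<open>theta_star\<close>.\<close>
locale convex_potential =
  fixes P P1 P2 :: "real \<Rightarrow> real" and S :: ereal
  assumes S_pos: "0 < S"
    and P_0: "P 0 = 0"
    and P: "\<And>t. ereal t < S \<Longrightarrow> (P has_real_derivative P1 t) (at t)"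
    and P1: "\<And>t. ereal t < S \<Longrightarrow> (P1 has_real_derivative P2 t) (at t)"
    and P1_pos: "0 < P1 0"
    and P2_pos: "\<And>t. 0 \<le> t \<Longrightarrow> ereal t < S \<Longrightarrow> 0 < P2 t"
begin

definition N where "N t = t * P1 t - P t"

definition root where "root K t \<longleftrightarrow> 2 * K < t \<and> ereal t < S \<and> N t - 2 * K * P1 t = 0"

text \<open>The derivative \<open>(x - 2 * K) * P2 x\<close> may vanish at the left end
  \<open>2 * K\<close>, so its sign is used on the open interval only. The case \<open>K = 0\<close>
  is included because it yields \<open>0 < N e\<close>.\<close>

lemma root_function_strict_mono:
  assumes "0 \<le> K" "2 * K \<le> s" "s < t" "ereal t < S"
  shows "N s - 2 * K * P1 s < N t - 2 * K * P1 t"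
proof (rule DERIV_pos_imp_increasing_open[OF \<open>s < t\<close>])
  fix x assume x: "s < x" "x < t"
  then have xS: "ereal x < S" using assms by (meson ereal_less_le less_imp_le order_le_less_trans ereal_less_eq(3))
  have "((\<lambda>t. N t - 2 * K * P1 t) has_real_derivative (x - 2 * K) * P2 x) (at x)"
    unfolding N_def using P[OF xS] P1[OF xS]
    by (auto intro!: derivative_eq_intros simp: algebra_simps)
  moreover have "(x - 2 * K) * P2 x > 0"
    using P2_pos[of x] xS x assms by (intro mult_pos_pos) auto
  ultimately show "\<exists>y. ((\<lambda>t. N t - 2 * K * P1 t) has_real_derivative y) (at x) \<and> 0 < y" by blast
next
  have "isCont (\<lambda>t. N t - 2 * K * P1 t) x" if "x \<in> {s..t}" for x
  proof -
    have "ereal x < S" using assms that by (meson atLeastAtMost_iff order_le_less_trans ereal_less_eq(3))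
    from P[OF this] P1[OF this] show ?thesis
      unfolding N_def by (intro continuous_intros) (auto intro: DERIV_isCont)
  qed
  then show "continuous_on {s..t} (\<lambda>t. N t - 2 * K * P1 t)"
    by (simp add: continuous_at_imp_continuous_on)
qed

text \<open>Fixes the sign at the left end of the root interval, where the function equals
  \<open>- P (2 * K)\<close>. Since \<open>P2\<close> is positive, \<open>P1\<close> stays above
  \<open>P1 0\<close>, so \<open>P\<close> increases from 0.\<close>

lemma P_pos:
  assumes "0 < t" "ereal t < S"
  shows "0 < P t"
proof -
  have lt: "ereal x < S" if "x \<le> t" for x
    using assms that by (meson order_le_less_trans ereal_less_eq(3))
  have P1_ge: "P1 0 \<le> P1 x" if "0 \<le> x" "x \<le> t" for x
  proof (rule DERIV_nonneg_imp_nondecreasing[OF that(1)])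
    fix y assume "0 \<le> y" "y \<le> x"
    then show "\<exists>z. (P1 has_real_derivative z) (at y) \<and> 0 \<le> z"
      using P1[OF lt, of y] P2_pos[OF _ lt, of y] that by (intro exI[of _ "P2 y"]) auto
  qed
  have "P 0 < P t"
  proof (rule DERIV_pos_imp_increasing[OF \<open>0 < t\<close>])
    fix y assume "0 \<le> y" "y \<le> t"
    then show "\<exists>z. (P has_real_derivative z) (at y) \<and> 0 < z"
      using P[OF lt, of y] P1_ge[of y] P1_pos by (intro exI[of _ "P1 y"]) auto
  qed
  then show ?thesis by (simp add: P_0)
qed

lemma eventually_pos:
  assumes "0 < e" "ereal e < S"
  shows "\<forall>\<^sub>F K in at_right 0. 0 < N e - 2 * K * P1 e"
proof -
  have "0 < N e" using root_function_strict_mono[of 0 0 e] assms by (simp add: N_def P_0)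
  moreover have "((\<lambda>K. N e - 2 * K * P1 e) \<longlongrightarrow> N e - 2 * 0 * P1 e) (at_right 0)"
    by (intro tendsto_intros)
  ultimately show ?thesis by (intro order_tendstoD(1)) auto
qed

text \<open>The intermediate value theorem on \<open>[2 * K, e]\<close> gives a root, and
  monotonicity makes it unique among all \<open>u\<close> with \<open>ereal u < S\<close>, not only
  below \<open>e\<close>. As \<open>e\<close> may be arbitrarily small, this also shows that the
  root tends to 0.\<close>

lemma eventually_root_less:
  assumes "0 < e" "ereal e < S"
  shows "\<forall>\<^sub>F K in at_right 0. \<exists>t. (\<forall>u. root K u \<longleftrightarrow> u = t) \<and> 0 < t \<and> t < e"
proof -
  have "\<forall>\<^sub>F K in at_right 0. 0 < K \<and> K < e / 2"
    unfolding eventually_at_right_field using assms by (auto intro!: exI[of _ "e / 2"])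
  with eventually_pos[OF assms] show ?thesis
  proof eventually_elim
    case (elim K)
    let ?F = "\<lambda>t. N t - 2 * K * P1 t"
    have lt: "ereal x < S" if "x \<le> e" for x
      using assms that by (meson order_le_less_trans ereal_less_eq(3))
    have neg: "?F (2 * K) < 0"
      using P_pos[of "2 * K"] lt[of "2 * K"] elim by (simp add: N_def)
    have "\<exists>t\<ge>2 * K. t \<le> e \<and> ?F t = 0"
    proof (rule IVT)
      show "\<forall>x. 2 * K \<le> x \<and> x \<le> e \<longrightarrow> isCont ?F x"
      proof safe
        fix x assume "x \<le> e"
        from P[OF lt[OF this]] P1[OF lt[OF this]] show "isCont ?F x"
          unfolding N_def by (intro continuous_intros) (auto intro: DERIV_isCont)
      qed
    qed (use neg elim in auto)
    then obtain t where t: "2 * K \<le> t" "t \<le> e" "?F t = 0" by blast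
    then have "t \<noteq> 2 * K" "t \<noteq> e" using neg elim by auto
    with t have t': "root K t" "t < e" "2 * K < t" by (auto simp: root_def lt)
    have "u = t" if "root K u" for u
      using root_function_strict_mono[of K u t] root_function_strict_mono[of K t u] that t' elim
      unfolding root_def by (cases u t rule: linorder_cases) auto
    with t' have "\<forall>u. root K u \<longleftrightarrow> u = t" by blast
    with t' elim show ?case by (intro exI[of _ t]) auto
  qed
qed

lemma eventually_ex1_root: "\<forall>\<^sub>F K in at_right 0. \<exists>!t. root K t"
proof -
  obtain e where "0 < e" "ereal e < S"
    using ereal_dense2[OF S_pos] by (auto simp: zero_ereal_def)
  then show ?thesis by (rule eventually_mono[OF eventually_root_less]) auto
qed

section \<open>Asymptotics of the root\<close>

text \<open>Splits \<open>N t\<close> as \<open>t * (P1 t - P1 0) - (P t - t * P1 0)\<close>, whose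
  quotients by \<open>t^2\<close> tend to \<open>P2 0\<close> and \<open>P2 0 / 2\<close>.
  L'Hospital's rule on \<open>N t / t^2\<close> itself would call for continuity of
  \<open>P2\<close> at 0, which the locale does not provide.\<close>

lemma tendsto_N_over_square: "((\<lambda>t. N t / t\<^sup>2) \<longlongrightarrow> P2 0 / 2) (at_right 0)"
proof -
  have P1_lim: "((\<lambda>t. (P1 t - P1 0) / t) \<longlongrightarrow> P2 0) (at_right 0)"
    using P1[of 0] S_pos unfolding has_field_derivative_iff
    by (auto simp: zero_ereal_def intro: tendsto_within_subset)
  obtain e where e: "0 < e" "ereal e < S"
    using ereal_dense2[OF S_pos] by (auto simp: zero_ereal_def)
  have ev: "\<forall>\<^sub>F t in at_right 0. 0 < t \<and> ereal t < S"
    unfolding eventually_at_right_field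
    using e by (intro exI[of _ e]) (auto intro: less_trans[of _ "ereal e"])
  have "((\<lambda>t. (P t - t * P1 0) / t\<^sup>2) \<longlongrightarrow> P2 0 / 2) (at_right 0)"
  proof (rule lhopital_right_0)
    have "((\<lambda>t. P t - t * P1 0) \<longlongrightarrow> P 0 - 0 * P1 0) (at_right 0)"
      using DERIV_isCont[OF P[of 0]] S_pos
      by (intro tendsto_intros) (auto simp: zero_ereal_def isCont_def intro: tendsto_within_subset)
    then show "((\<lambda>t. P t - t * P1 0) \<longlongrightarrow> 0) (at_right 0)" by (simp add: P_0)
    show "((\<lambda>t. t\<^sup>2 :: real) \<longlongrightarrow> 0) (at_right 0)" by (auto intro!: tendsto_eq_intros)
    show "\<forall>\<^sub>F t :: real in at_right 0. t\<^sup>2 \<noteq> 0" "\<forall>\<^sub>F t :: real in at_right 0. 2 * t \<noteq> 0"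
      using ev by (auto elim!: eventually_mono)
    show "\<forall>\<^sub>F t in at_right 0. ((\<lambda>t. P t - t * P1 0) has_real_derivative P1 t - P1 0) (at t)"
      using ev by eventually_elim (auto intro!: derivative_eq_intros P)
    show "\<forall>\<^sub>F t :: real in at_right 0. ((\<lambda>t. t\<^sup>2) has_real_derivative 2 * t) (at t)"
      by (auto intro!: always_eventually derivative_eq_intros)
    show "((\<lambda>t. (P1 t - P1 0) / (2 * t)) \<longlongrightarrow> P2 0 / 2) (at_right 0)"
      using tendsto_divide[OF P1_lim tendsto_const[of 2]] by (simp add: mult.commute)
  qed
  from tendsto_diff[OF P1_lim this]
  have "((\<lambda>t. (P1 t - P1 0) / t - (P t - t * P1 0) / t\<^sup>2) \<longlongrightarrow> P2 0 / 2) (at_right 0)"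
    by simp
  then show ?thesis
    by (rule Lim_transform_eventually)
       (use ev in eventually_elim, simp add: N_def field_simps power2_eq_square)
qed

lemma N_root_asymptotics:
  "(\<lambda>K. N (THE t. root K t) - (2 * P1 0 * K + 4 * sqrt (P1 0 * P2 0) * K powr (3/2)))
     \<in> o[at_right 0](\<lambda>K. K powr (3/2))"
proof -
  define T where "T K = (THE t. root K t)" for K
  define m v where "m = P1 0" and "v = P2 0"
  have m: "0 < m" and v: "0 < v"
    using P1_pos P2_pos[of 0] S_pos by (auto simp: m_def v_def zero_ereal_def)
  obtain e where e: "0 < e" "ereal e < S"
    using ereal_dense2[OF S_pos] by (auto simp: zero_ereal_def)
  have small: "\<forall>\<^sub>F K in at_right 0. root K (T K) \<and> 0 < T K \<and> T K < d"
    if "0 < d" "ereal d < S" for d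
    using eventually_root_less[OF that] by eventually_elim (auto simp: T_def)
  \<comment> \<open>Convergence from the right lets the one-sided limits in \<open>t\<close> be
    composed with \<open>T\<close>.\<close>
  have T_lim: "filterlim T (at_right 0) (at_right 0)"
    unfolding filterlim_at_right_to_0[symmetric] filterlim_at
  proof safe
    show "\<forall>\<^sub>F K in at_right 0. T K \<in> {0<..} \<and> T K \<noteq> 0"
      using small[OF e] by eventually_elim auto
    show "(T \<longlongrightarrow> 0) (at_right 0)"
    proof (rule order_tendstoI)
      fix a :: real assume "a < 0"
      then show "\<forall>\<^sub>F K in at_right 0. a < T K" using small[OF e] by (auto elim!: eventually_mono)
    next
      fix a :: real assume "0 < a"
      moreover have "ereal (min a e) < S"
        using e by (meson min.cobounded2 order_le_less_trans ereal_less_eq(3))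
      ultimately show "\<forall>\<^sub>F K in at_right 0. T K < a"
        using small[of "min a e"] e by (auto elim!: eventually_mono)
    qed
  qed
  have P1_lim: "((\<lambda>t. (P1 t - m) / t) \<longlongrightarrow> v) (at_right 0)"
    using P1[of 0] S_pos unfolding has_field_derivative_iff m_def v_def
    by (auto simp: zero_ereal_def intro: tendsto_within_subset)
  have P1_cont: "(P1 \<longlongrightarrow> m) (at_right 0)"
    using DERIV_isCont[OF P1[of 0]] S_pos
    by (auto simp: m_def zero_ereal_def isCont_def intro: tendsto_within_subset)
  have ev: "\<forall>\<^sub>F K in at_right 0. 0 < K \<and> 0 < T K \<and> N (T K) = 2 * K * P1 (T K) \<and> 0 < P1 (T K)"
    using small[OF e] eventually_at_right_less[of 0]
      order_tendstoD(1)[OF filterlim_compose[OF P1_cont T_lim] m]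
    by eventually_elim (auto simp: root_def)
  \<comment> \<open>At the root \<open>N (T K) = 2 * K * P1 (T K)\<close>, so this quotient is
    exactly \<open>(T K)^2 / K\<close>.\<close>
  have "((\<lambda>K. 2 * P1 (T K) / (N (T K) / (T K)\<^sup>2)) \<longlongrightarrow> 2 * m / (v / 2)) (at_right 0)"
    using v unfolding v_def
    by (intro tendsto_intros filterlim_compose[OF P1_cont T_lim]
          filterlim_compose[OF tendsto_N_over_square T_lim]) auto
  then have "((\<lambda>K. (T K)\<^sup>2 / K) \<longlongrightarrow> 4 * m / v) (at_right 0)"
    by (rule Lim_transform_eventually[OF tendsto_eq_rhs])
       (simp, use ev in eventually_elim, simp add: field_simps)
  then have sqrt_lim: "((\<lambda>K. sqrt ((T K)\<^sup>2 / K)) \<longlongrightarrow> sqrt (4 * m / v)) (at_right 0)"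
    by (rule tendsto_real_sqrt)
  \<comment> \<open>This is the remainder divided by \<open>K powr (3/2)\<close>, rewritten with
    \<open>N (T K) = 2 * K * P1 (T K)\<close> and the factor \<open>T K / sqrt K\<close> split
    off.\<close>
  have "((\<lambda>K. 2 * ((P1 (T K) - m) / T K) * sqrt ((T K)\<^sup>2 / K) - 4 * sqrt (m * v))
               \<longlongrightarrow> 2 * v * sqrt (4 * m / v) - 4 * sqrt (m * v)) (at_right 0)"
    by (intro tendsto_diff tendsto_mult tendsto_const sqrt_lim filterlim_compose[OF P1_lim T_lim])
  also have "2 * v * sqrt (4 * m / v) - 4 * sqrt (m * v) = 0"
  proof -
    have "v = sqrt v * sqrt v" using v by simp
    then show ?thesis using v m
      by (simp add: real_sqrt_mult real_sqrt_divide field_simps)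
  qed
  finally have "((\<lambda>K. (N (T K) - (2 * m * K + 4 * sqrt (m * v) * K powr (3/2))) / K powr (3/2))
                   \<longlongrightarrow> 0) (at_right 0)"
  proof (rule Lim_transform_eventually, use ev in eventually_elim)
    case (elim K)
    have K32: "K powr (3/2) = K * sqrt K"
      using elim powr_add[of K 1 "1/2"] by (simp add: powr_half_sqrt)
    have sqrt_eq: "sqrt ((T K)\<^sup>2 / K) = T K / sqrt K" using elim by (simp add: real_sqrt_divide)
    have N_eq: "N (T K) = 2 * K * P1 (T K)" using elim by blast
    show ?case using elim unfolding K32 sqrt_eq N_eq by (simp add: field_simps)
  qed
  then show ?thesis
    unfolding T_def m_def v_def
    by (rule smalloI_tendsto) (use eventually_at_right_less[of 0] in eventually_elim, simp)
qed

end

section \<open>The potential generated by the squared norm of the drift\<close>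

text \<open>Unique solvability for small \<open>K\<close> belongs to the conclusion, since it gives
  the definite description in \<open>theta_K\<close> its meaning.\<close>

theorem theorem7:
  fixes f :: "real ^ 'n \<Rightarrow> real ^ 'n"
    and g :: "real ^ 'n \<Rightarrow> real ^ 'm ^ 'n"
    and h :: "real ^ 'n \<Rightarrow> real ^ 'm"
    and p :: "real ^ 'n \<Rightarrow> real"
  assumes "C1 f" and "lipschitz_map f"
    and "C2 g" and "lipschitz_map g"
    and "C1 h" and "lipschitz_map h"
    and "invariant_pdf f g p"
    and "\<And>q. invariant_pdf f g q \<Longrightarrow> q = p"
    and "\<not> (\<lambda>x. norm (h x)) constant_on UNIV"
    and "theta_star p h > 0"
  shows "(\<forall>\<^sub>F K in at_right 0. \<exists>!\<theta>. is_theta_K p h K \<theta>) \<and>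
         (\<lambda>K. nu p h (theta_K p h K)
            - (2 * expect p (\<lambda>x. (norm (h x))\<^sup>2) * K
               + 4 * sqrt (expect p (\<lambda>x. (norm (h x))\<^sup>2) * var p (\<lambda>x. (norm (h x))\<^sup>2))
                   * K powr (3/2)))
         \<in> o[at_right 0](\<lambda>K. K powr (3/2)) \<and>
         var p (\<lambda>x. (norm (h x))\<^sup>2)
         = expect p (\<lambda>x. (norm (h x)) ^ 4) - (expect p (\<lambda>x. (norm (h x))\<^sup>2))\<^sup>2"
proof -
  define X where "X x = (norm (h x))\<^sup>2" for x
  define \<mu> where "\<mu> = density lborel p"
  define S where "S = theta_star p h"
  \<comment> \<open>The \<open>k\<close>-th derivative of the moment generating function of
    \<open>X\<close>, as \<open>m_deriv\<close> confirms.\<close>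
  define m where "m k t = (LINT x|\<mu>. X x ^ k * exp (t * X x))" for k :: nat and t
  define P2 where "P2 t = m 2 t / m 0 t - (m 1 t / m 0 t)\<^sup>2" for t
  have p: "\<And>x. 0 < p x" "(\<integral>\<^sup>+ x. ennreal (p x) \<partial>lborel) = 1"
    using \<open>invariant_pdf f g p\<close> by (auto simp: invariant_pdf_def)
  have pc: "continuous_on UNIV p"
    using \<open>invariant_pdf f g p\<close> unfolding invariant_pdf_def C2_def
    by (meson continuous_at_imp_continuous_on has_derivative_continuous)
  have hc: "continuous_on UNIV h"
    using \<open>C1 h\<close> unfolding C1_def
    by (meson continuous_at_imp_continuous_on has_derivative_continuous)
  have Xc: "continuous_on UNIV X" unfolding X_def using hc by (intro continuous_intros)
  have X0: "0 \<le> X x" for x by (simp add: X_def)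
  have [measurable]: "p \<in> borel_measurable borel" "X \<in> borel_measurable borel"
    using pc Xc by (auto intro: borel_measurable_continuous_onI)
  have X\<mu>[measurable]: "X \<in> borel_measurable \<mu>" by (simp add: \<mu>_def)
  have nonconst: "\<exists>x. X x \<noteq> c" for c
  proof (rule ccontr)
    assume "\<nexists>x. X x \<noteq> c"
    then have "norm (h x) = sqrt c" for x by (metis X_def norm_ge_zero real_sqrt_abs abs_of_nonneg)
    then show False using assms(9) by (auto simp: constant_on_def)
  qed
  have expect_eq: "expect p \<phi> = (LINT x|\<mu>. \<phi> x)" if "continuous_on UNIV \<phi>" for \<phi>
  proof -
    have "\<phi> \<in> borel_measurable borel" using that by (rule borel_measurable_continuous_onI)
    then show ?thesis using p(1)
      unfolding expect_def \<mu>_def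
      by (subst integral_density) (auto simp: less_imp_le mult.commute)
  qed
  \<comment> \<open>Being below the supremum supplies an admissible exponent strictly above
    \<open>t\<close>, which is the gap that the moment lemmas consume.\<close>
  have exp_int: "\<exists>b>t. integrable \<mu> (\<lambda>x. exp (b * X x))" if "ereal t < S" for t
  proof -
    from that obtain b where b: "t < b"
      "(\<integral>\<^sup>+ x. ennreal (exp (b * X x) * p x) \<partial>lborel) < \<infinity>"
      unfolding S_def theta_star_def less_SUP_iff X_def by auto
    have "integrable lborel (\<lambda>x. exp (b * X x) * p x)"
      using b p(1) by (intro integrableI_nonneg) (auto simp: less_imp_le)
    then show ?thesis using b(1) p(1) unfolding \<mu>_def
      by (subst integrable_density | auto simp: less_imp_le mult.commute)+
  qed
  have int: "integrable \<mu> (\<lambda>x. X x ^ k * exp (t * X x))" if "ereal t < S" for t k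
    using exp_int[OF that] integrable_power_times_exp[OF X\<mu> X0] by blast
  have m_deriv: "(m k has_real_derivative m (Suc k) t) (at t)" if "ereal t < S" for t k
    unfolding m_def[abs_def]
    using exp_int[OF that] has_derivative_integral_power_times_exp[OF X\<mu> X0] by blast
  note pos = integral_density_lborel_pos[OF pc p(1), folded \<mu>_def]
  have m0_pos: "0 < m 0 t" if "ereal t < S" for t
    unfolding m_def using int[OF that, of 0]
    by (intro pos) (auto intro!: continuous_intros Xc)
  have S0: "ereal 0 < S" using assms(10) by (simp add: S_def zero_ereal_def)
  have m1_pos: "0 < m 1 0"
  proof -
    obtain z where "X z \<noteq> 0" using nonconst by blast
    then have "0 < X z" using X0[of z] by simp
    then show ?thesis unfolding m_def using int[OF S0, of 1] X0
      by (intro pos[where z = z]) (auto intro!: continuous_intros Xc)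
  qed
  have m00: "m 0 0 = 1"
  proof -
    have "emeasure \<mu> (space \<mu>) = 1"
      unfolding \<mu>_def using p(2) by (subst emeasure_density) auto
    then show ?thesis by (simp add: m_def measure_def)
  qed
  \<comment> \<open>\<open>P2 t\<close> is the variance of \<open>X\<close> under the measure tilted by \<open>exp (t * X)\<close>.\<close>
  have tilt: "(LINT x|\<mu>. (X x - c)\<^sup>2 * exp (t * X x)) = m 2 t - 2 * c * m 1 t + c\<^sup>2 * m 0 t
      \<and> integrable \<mu> (\<lambda>x. (X x - c)\<^sup>2 * exp (t * X x))" if "ereal t < S" for t c
  proof -
    note I = int[OF that, of 0] int[OF that, of 1] int[OF that, of 2]
    have eq: "(\<lambda>x. (X x - c)\<^sup>2 * exp (t * X x))
      = (\<lambda>x. X x ^ 2 * exp (t * X x) - 2 * c * (X x ^ 1 * exp (t * X x)) + c\<^sup>2 * (X x ^ 0 * exp (t * X x)))"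
      by (auto simp: power2_eq_square algebra_simps)
    show ?thesis unfolding eq m_def using I by simp
  qed
  have P2_pos: "0 < P2 t" if "ereal t < S" for t
  proof -
    \<comment> \<open>The tilted mean: with this centre the second moment, normalised by
      \<open>m 0 t\<close>, is \<open>P2 t\<close>.\<close>
    define c where "c = m 1 t / m 0 t"
    obtain z where "X z \<noteq> c" using nonconst by blast
    then have "0 < (LINT x|\<mu>. (X x - c)\<^sup>2 * exp (t * X x))"
      using tilt[OF that] by (intro pos[where z = z]) (auto intro!: continuous_intros Xc)
    then have "0 < (m 2 t - 2 * c * m 1 t + c\<^sup>2 * m 0 t) / m 0 t"
      using tilt[OF that] m0_pos[OF that] by simp
    also have "\<dots> = P2 t" using m0_pos[OF that]
      by (simp add: P2_def c_def field_simps power2_eq_square)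
    finally show ?thesis .
  qed
  have Psi_eq: "Psi p h t = ln (m 0 t)" for t
    unfolding Psi_def m_def X_def[symmetric]
    by (subst expect_eq) (auto intro!: continuous_intros Xc)
  have Psi': "(Psi p h has_real_derivative m 1 t / m 0 t) (at t)" if "ereal t < S" for t
    unfolding Psi_eq[abs_def] using m_deriv[OF that, of 0] m0_pos[OF that]
    by (auto intro!: derivative_eq_intros)
  \<comment> \<open>The formula for \<open>deriv (Psi p h)\<close> holds only below
    \<open>S\<close>; differentiating it once more needs it on a whole neighbourhood of
    \<open>t\<close>.\<close>
  have near: "\<forall>\<^sub>F u in nhds t. ereal u < S" if "ereal t < S" for t
  proof -
    have "open {u. ereal u < S}" 
      by (intro open_Collect_less continuous_on_ereal continuous_on_id continuous_on_const)
    then show ?thesis using that eventually_nhds by blast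
  qed
  have deriv_Psi: "deriv (Psi p h) t = m 1 t / m 0 t" if "ereal t < S" for t
    using Psi'[OF that] by (rule DERIV_imp_deriv)
  interpret convex_potential "Psi p h" "deriv (Psi p h)" P2 S
  proof
    show "0 < S" using S0 by (simp add: zero_ereal_def)
    show "Psi p h 0 = 0" by (simp add: Psi_eq m00)
    show "0 < deriv (Psi p h) 0" using m1_pos by (simp add: deriv_Psi S0 m00)
    fix t assume t: "ereal t < S"
    show "(Psi p h has_real_derivative deriv (Psi p h) t) (at t)"
      using Psi'[OF t] deriv_Psi[OF t] by simp
    have D: "((\<lambda>t. m 1 t / m 0 t) has_real_derivative P2 t) (at t)"
      using m_deriv[OF t, of 0] m_deriv[OF t, of 1] m0_pos[OF t]
      by (auto intro!: derivative_eq_intros simp: P2_def field_simps power2_eq_square numeral_2_eq_2)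
    have eq: "\<forall>\<^sub>F u in nhds t. deriv (Psi p h) u = m 1 u / m 0 u"
      using near[OF t] by eventually_elim (rule deriv_Psi)
    from D show "(deriv (Psi p h) has_real_derivative P2 t) (at t)"
      by (rule DERIV_cong_ev[OF refl eq refl, THEN iffD2])
    show "0 < P2 t" using P2_pos[OF t] .
  qed
  have N_eq: "N = nu p h" by (auto simp: N_def nu_def)
  \<comment> \<open>Equality of the predicates turns the \<open>THE\<close> of the abstract result
    into \<open>theta_K\<close>.\<close>
  have root_eq: "root = is_theta_K p h"
    by (simp add: root_def is_theta_K_def N_eq S_def[symmetric] fun_eq_iff)
  have mean: "expect p X = m 1 0" using Xc by (simp add: expect_eq m_def)
  \<comment> \<open>At \<open>t = 0\<close> the tilt is trivial and \<open>m 0 0 = 1\<close>, so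
    \<open>tilt\<close> centred at the mean is the ordinary variance identity.\<close>
  have "var p X = m 2 0 - (m 1 0)\<^sup>2"
    using tilt[OF S0, of "m 1 0"] m00 unfolding var_def mean
    by (subst expect_eq) (auto intro!: continuous_intros Xc simp: power2_eq_square)
  moreover have "expect p (\<lambda>x. norm (h x) ^ 4) = m 2 0"
    by (subst expect_eq) (auto intro!: continuous_intros hc simp: m_def X_def)
  moreover have "deriv (Psi p h) 0 = m 1 0" "P2 0 = m 2 0 - (m 1 0)\<^sup>2"
    by (auto simp: deriv_Psi S0 m00 P2_def)
  ultimately show ?thesis
    using eventually_ex1_root N_root_asymptotics mean
    unfolding root_eq N_eq theta_K_def[abs_def] X_def[abs_def] by simp
qed

end
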